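(* Let $\alpha > 0$ be a constant. Suppose that $H$ is a connected graph on $n$ vertices in which at least $(1-\alpha)n$ vertices are cutvertices. Then at least $(1-7\alpha)n$ vertices of $H$ have degree equal to $2$.
   Context: All graphs are finite and simple. A cutvertex of a connected graph $H$ is a vertex $v$ such that $H - v$ is disconnected. *)

theory Defs
  imports Complex_Main "Graph_Theory.Graph_Theory"
begin

text \<open>
  Finite simple graphs are the library's \<open>graph\<close>: finite, loop-free, symmetric digraphs without
  parallel arcs. An undirected edge is a pair of opposite arcs, so the degree of a vertex is its
  \<open>out_degree\<close>. The name \<open>connected\<close> is qualified because it also denotes topological
  connectedness.
\<close>

text \<open>
  The library's \<open>connected\<close> is false for the graph without vertices. That graph must not count as
  disconnected either, since otherwise the vertex of a one-vertex graph would be a cutvertex.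
\<close>

definition disconnected :: "('a, 'b) pre_digraph \<Rightarrow> bool" where
  "disconnected G \<longleftrightarrow> verts G \<noteq> {} \<and> \<not> Digraph_Component.connected G"

definition cutvertex :: "('a, 'b) pre_digraph \<Rightarrow> 'a \<Rightarrow> bool" where
  "cutvertex G v \<longleftrightarrow> v \<in> verts G \<and> disconnected (pre_digraph.del_vert G v)"

end

theory Submission
  imports Defs
begin

text \<open>
  Fix any rooted spanning tree and call a vertex special if it is the root, is not a cutvertex,
  or does not have exactly one child. Childless vertices are not cutvertices, and a tree has fewer
  branching vertices than leaves, so there are at most twice as many special vertices as
  non-cutvertices. Deleting a vertex that is not special leaves exactly two components, the part
  of the tree below it and the rest. Hence if a vertex that is not special has a third neighbour,
  the tree neighbour in the direction of that neighbour is special. The special vertices have fewer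
  children than there are special vertices, so at most six times as many vertices as there are
  non-cutvertices have degree other than two.
\<close>

section \<open>Connectivity after deletion of a vertex\<close>

definition avoiding :: "('a \<times> 'a) set \<Rightarrow> 'a \<Rightarrow> ('a \<times> 'a) set" where
  "avoiding E a = {(x, y) \<in> E. x \<noteq> a \<and> y \<noteq> a}"

text \<open>For \<open>a\<close> in \<open>V\<close> this says that \<open>a\<close> is not a
  cutvertex. It holds vacuously if \<open>V\<close> is \<open>{a}\<close>, in line with the
  convention that the graph without vertices is not disconnected.\<close>

definition connected_without :: "'a set \<Rightarrow> ('a \<times> 'a) set \<Rightarrow> 'a \<Rightarrow> bool" where
  "connected_without V E a \<longleftrightarrow> (\<forall>x \<in> V - {a}. \<forall>y \<in> V - {a}. (x, y) \<in> (avoiding E a)\<^sup>*)"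

lemma sym_avoiding: "sym E \<Longrightarrow> sym (avoiding E a)"
  by (auto simp: avoiding_def sym_def)

lemma connected_withoutI:
  assumes "sym E" and "\<And>x. x \<in> V \<Longrightarrow> x \<noteq> a \<Longrightarrow> (x, r) \<in> (avoiding E a)\<^sup>*"
  shows "connected_without V E a"
  unfolding connected_without_def
proof (intro ballI)
  fix x y assume "x \<in> V - {a}" "y \<in> V - {a}"
  then have "(x, r) \<in> (avoiding E a)\<^sup>*" "(y, r) \<in> (avoiding E a)\<^sup>*"
    using assms(2) by auto
  moreover have "sym ((avoiding E a)\<^sup>*)"
    using assms(1) by (intro sym_rtrancl sym_avoiding)
  ultimately show "(x, y) \<in> (avoiding E a)\<^sup>*"
    by (meson rtrancl_trans symD)
qed

text \<open>Strict decrease of \<open>depth\<close> along \<open>par\<close> rules out cycles and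
  makes every climb end at \<open>r\<close>.\<close>

locale rooted_spanning_tree =
  fixes V :: "'a set" and E :: "('a \<times> 'a) set" and r :: 'a
    and par :: "'a \<Rightarrow> 'a" and depth :: "'a \<Rightarrow> nat"
  assumes finite_V: "finite V"
    and root: "r \<in> V"
    and edges: "E \<subseteq> V \<times> V"
    and sym_E: "sym E"
    and irrefl_E: "(x, x) \<notin> E"
    and par_edge: "v \<in> V \<Longrightarrow> v \<noteq> r \<Longrightarrow> (v, par v) \<in> E"
    and par_depth: "v \<in> V \<Longrightarrow> v \<noteq> r \<Longrightarrow> depth (par v) < depth v"
begin

definition up :: "('a \<times> 'a) set" where
  "up = {(v, par v) |v. v \<in> V - {r}}"

definition children :: "'a \<Rightarrow> 'a set" where
  "children a = {v \<in> V - {r}. par v = a}"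

definition special :: "'a set" where
  "special = {a \<in> V. a = r \<or> connected_without V E a \<or> card (children a) \<noteq> 1}"

lemma par_in_V: "v \<in> V \<Longrightarrow> v \<noteq> r \<Longrightarrow> par v \<in> V"
  using par_edge edges by blast

lemma finite_children: "finite (children a)"
  using finite_V by (simp add: children_def)

lemma up_depth: "(v, a) \<in> up\<^sup>* \<Longrightarrow> depth a \<le> depth v"
  by (induction rule: converse_rtrancl_induct) (auto simp: up_def dest: par_depth)

lemma up_root: "v \<in> V \<Longrightarrow> (v, r) \<in> up\<^sup>*"
proof (induction "depth v" arbitrary: v rule: less_induct)
  case less
  show ?case
  proof (cases "v = r")
    case False
    then have "(par v, r) \<in> up\<^sup>*" using less par_depth par_in_V by blast
    moreover have "(v, par v) \<in> up" using False less.prems by (auto simp: up_def)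
    ultimately show ?thesis by (rule converse_rtrancl_into_rtrancl[rotated])
  qed simp
qed

lemma up_avoiding:
  assumes "v \<in> V" "v \<noteq> r" "v \<noteq> a" "par v \<noteq> a"
  shows "(v, par v) \<in> avoiding E a"
  using assms par_edge by (auto simp: avoiding_def)

text \<open>A climb along \<open>par\<close> can enter \<open>a\<close> only from a child of
  \<open>a\<close>, so without children nothing blocks the way to \<open>r\<close>.\<close>

lemma leaf_connected_without:
  assumes "children a = {}"
  shows "connected_without V E a"
proof (rule connected_withoutI[OF sym_E])
  fix x assume "x \<in> V" "x \<noteq> a"
  then show "(x, r) \<in> (avoiding E a)\<^sup>*"
  proof (induction "depth x" arbitrary: x rule: less_induct)
    case less
    show ?case
    proof (cases "x = r")
      case False
      then have "par x \<noteq> a" using less.prems assms by (auto simp: children_def)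
      then show ?thesis
        using less False par_depth par_in_V up_avoiding
        by (meson converse_rtrancl_into_rtrancl)
    qed simp
  qed
qed

text \<open>Climb from \<open>x\<close> along \<open>par\<close>: only \<open>c\<close> has parent
  \<open>a\<close>, so the climb reaches \<open>r\<close> or stops at \<open>c\<close>.\<close>

lemma reach_avoiding_or_below:
  assumes "children a = {c}" and "x \<in> V" "x \<noteq> a"
  shows "(x, r) \<in> (avoiding E a)\<^sup>* \<or> (x, c) \<in> (avoiding E a)\<^sup>* \<and> (x, c) \<in> up\<^sup>*"
  using assms(2,3)
proof (induction "depth x" arbitrary: x rule: less_induct)
  case less
  consider "x = r" | "x = c" | "x \<noteq> r" "x \<noteq> c" by blast
  then show ?case
  proof cases
    case 3
    then have "par x \<noteq> a" using less.prems assms by (auto simp: children_def)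
    moreover from this have "(x, par x) \<in> avoiding E a"
      using 3 less.prems up_avoiding by blast
    moreover have "(x, par x) \<in> up" using 3 less.prems by (auto simp: up_def)
    ultimately show ?thesis
      using less 3 par_depth par_in_V by (meson converse_rtrancl_into_rtrancl)
  qed auto
qed

text \<open>All vertices on the climb to \<open>c\<close> are at least as deep as \<open>c\<close>,
  hence deeper than \<open>a\<close>.\<close>

lemma below_avoiding:
  assumes "c \<in> children a" and "(x, c) \<in> up\<^sup>*"
  shows "(x, c) \<in> (avoiding E a)\<^sup>*"
  using assms(2)
proof (induction rule: converse_rtrancl_induct)
  case (step x y)
  have "depth a < depth c" using assms(1) par_depth by (auto simp: children_def)
  then have "depth a < depth y" using up_depth[OF step.hyps(2)] by linarith
  moreover have "depth y < depth x" "x \<in> V" "x \<noteq> r" "y = par x"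
    using step.hyps(1) par_depth by (auto simp: up_def)
  ultimately have "(x, y) \<in> avoiding E a" using up_avoiding[of x a] by force
  then show ?case using step.IH by (rule converse_rtrancl_into_rtrancl)
qed simp

text \<open>Deleting \<open>a\<close> leaves at most two pieces, the one with \<open>r\<close> and
  the one below \<open>c\<close>; the edge from \<open>x\<close> to \<open>y\<close> joins
  them.\<close>

lemma crossing_edge_connected_without:
  assumes c: "children a = {c}" and xy: "(x, y) \<in> avoiding E a"
    and x: "(x, r) \<in> (avoiding E a)\<^sup>*" and y: "(y, c) \<in> up\<^sup>*"
  shows "connected_without V E a"
proof (rule connected_withoutI[OF sym_E])
  have sym: "sym ((avoiding E a)\<^sup>*)"
    using sym_E by (intro sym_rtrancl sym_avoiding)
  have "(y, c) \<in> (avoiding E a)\<^sup>*" using below_avoiding c y by blast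
  then have "(c, r) \<in> (avoiding E a)\<^sup>*"
    using sym xy x by (meson r_into_rtrancl rtrancl_trans symD)
  then show "(z, r) \<in> (avoiding E a)\<^sup>*" if "z \<in> V" "z \<noteq> a" for z
    using reach_avoiding_or_below[OF c that] by (meson rtrancl_trans)
qed

section \<open>Edges outside the tree and special vertices\<close>

lemma children_nonspecial:
  assumes "a \<in> V" "a \<notin> special"
  obtains c where "children a = {c}"
  using assms by (auto simp: special_def card_1_singleton_iff)

text \<open>The edge to \<open>w\<close> bypasses a tree neighbour of \<open>v\<close>: the child of
  \<open>v\<close> towards \<open>w\<close> if \<open>w\<close> lies below \<open>v\<close>, and
  \<open>par v\<close> otherwise. By \<open>crossing_edge_connected_without\<close> that tree
  neighbour must be special.\<close>

lemma extra_neighbour: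
  assumes v: "v \<in> V" and vw: "(v, w) \<in> E"
    and extra: "w \<notin> children v" "v = r \<or> w \<noteq> par v"
  shows "v \<in> (\<Union>a\<in>special. children a) \<or> v \<in> par ` special"
proof (cases "(w, v) \<in> up\<^sup>*")
  case True
  have "w \<noteq> v" using vw irrefl_E by blast
  \<comment> \<open>\<open>a\<close> is the child of \<open>v\<close> on the tree path from
    \<open>w\<close>.\<close>
  then obtain a where wa: "(w, a) \<in> up\<^sup>*" and "(a, v) \<in> up"
    using True by (metis rtranclE)
  then have a: "a \<in> V" "a \<noteq> r" "par a = v" by (auto simp: up_def)
  then have "w \<noteq> a" using extra by (auto simp: children_def)
  have "a \<in> special"
  proof (rule ccontr)
    assume ns: "a \<notin> special"
    with a obtain c where c: "children a = {c}" using children_nonspecial by blast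
    obtain b where wb: "(w, b) \<in> up\<^sup>*" and "(b, a) \<in> up"
      using wa \<open>w \<noteq> a\<close> by (metis rtranclE)
    then have "b \<in> children a" by (auto simp: up_def children_def)
    then have wc: "(w, c) \<in> up\<^sup>*" using wb c by auto
    have va: "depth v < depth a" using a par_depth by blast
    have "c \<in> V" "c \<noteq> r" "par c = a" using c by (auto simp: children_def)
    then have "depth a < depth c" using par_depth by blast
    \<comment> \<open>\<open>v\<close> is shallower than \<open>c\<close>, so it does not lie below
      \<open>c\<close> and belongs to the piece of the root.\<close>
    then have "(v, c) \<notin> up\<^sup>*" using va up_depth by fastforce
    then have "(v, r) \<in> (avoiding E a)\<^sup>*"
      using reach_avoiding_or_below[OF c v] va by blast
    moreover have "(v, w) \<in> avoiding E a" using vw va \<open>w \<noteq> a\<close> by (auto simp: avoiding_def)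
    ultimately have "connected_without V E a"
      using crossing_edge_connected_without c wc by blast
    then show False using ns a by (auto simp: special_def)
  qed
  then show ?thesis using a by blast
next
  case False
  have wV: "w \<in> V" using vw edges by blast
  \<comment> \<open>Every vertex lies below \<open>r\<close>, while \<open>w\<close> does not lie
    below \<open>v\<close>.\<close>
  have vr: "v \<noteq> r" using False up_root wV by blast
  then have wp: "w \<noteq> par v" using extra by blast
  have "par v \<in> special"
  proof (rule ccontr)
    assume ns: "par v \<notin> special"
    obtain c where "children (par v) = {c}"
      using children_nonspecial ns par_in_V v vr by blast
    moreover have "v \<in> children (par v)" using v vr by (auto simp: children_def)
    ultimately have c: "children (par v) = {v}" by auto
    have "(w, r) \<in> (avoiding E (par v))\<^sup>*"
      using reach_avoiding_or_below[OF c wV wp] False by blast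
    moreover have "(w, v) \<in> avoiding E (par v)"
      using vw wp par_depth[OF v vr] symD[OF sym_E vw] by (auto simp: avoiding_def)
    ultimately have "connected_without V E (par v)"
      using crossing_edge_connected_without c by blast
    then show False using ns par_in_V v vr by (auto simp: special_def)
  qed
  then show ?thesis using v vr by (auto simp: children_def)
qed

text \<open>A nonspecial vertex has one child and a parent, distinct by \<open>depth\<close>;
  outside the other two sets \<open>extra_neighbour\<close> leaves no third neighbour.\<close>

lemma degree_two_or_near_special:
  assumes v: "v \<in> V" and deg: "card (E `` {v}) \<noteq> 2"
  shows "v \<in> special \<union> (\<Union>a\<in>special. children a) \<union> par ` special"
proof (rule ccontr)
  assume not_near: "\<not> ?thesis"
  then have ns: "v \<notin> special" by blast
  then have vr: "v \<noteq> r" using v by (auto simp: special_def)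
  obtain c where c: "children v = {c}" using children_nonspecial ns v by blast
  then have c': "c \<in> V" "c \<noteq> r" "par c = v" by (auto simp: children_def)
  have "E `` {v} \<subseteq> {c, par v}"
    using extra_neighbour[OF v] not_near c vr by blast
  moreover have "(v, c) \<in> E" using par_edge[OF c'(1,2)] c'(3) sym_E by (auto dest: symD)
  moreover have "(v, par v) \<in> E" using par_edge v vr by blast
  ultimately have "E `` {v} = {c, par v}" by blast
  moreover have "c \<noteq> par v"
    using par_depth[OF v vr] par_depth[OF c'(1,2)] c'(3) by auto
  ultimately show False using deg by simp
qed

section \<open>Counting special vertices and their tree neighbours\<close>

text \<open>Each vertex other than \<open>r\<close> is a child of exactly one vertex, so the numbers
  of children add up to \<open>card V - 1\<close>.\<close>

lemma sum_children: "(\<Sum>a\<in>V. int (card (children a)) - 1) = -1"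
proof -
  have "(\<Sum>a\<in>V. card (children a)) = card (V - {r})"
    using sum.group[of "V - {r}" V par "\<lambda>_. 1::nat"] finite_V par_in_V
    by (simp add: children_def image_subset_iff)
  also have "int \<dots> = int (card V) - 1"
    using root finite_V by (metis card_Suc_Diff1 add_diff_cancel_left' of_nat_Suc)
  finally show ?thesis by (simp add: sum_subtractf)
qed

lemma card_special:
  "card special \<le> 2 * card {a \<in> V. connected_without V E a}"
proof -
  define K where "K = {a \<in> V. connected_without V E a}"
  define L where "L = {a \<in> V. card (children a) = 0}"
  define B where "B = {a \<in> V. card (children a) \<ge> 2}"
  have fin: "finite K" "finite L" "finite B"
    using finite_V by (auto simp: K_def L_def B_def)
  have "L \<subseteq> K"
    using finite_children leaf_connected_without by (auto simp: K_def L_def)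
  then have LK: "card L \<le> card K" using fin card_mono by blast
  \<comment> \<open>A leaf contributes -1, a vertex with one child 0 and a branching vertex at least
    1 to the sum in \<open>sum_children\<close>.\<close>
  have "int (card B) - int (card L) = (\<Sum>a\<in>V. of_bool (a \<in> B) - of_bool (a \<in> L))"
    using finite_V
    by (simp add: sum_subtractf sum.If_cases of_bool_def B_def L_def Int_def conj_commute)
  also have "\<dots> \<le> (\<Sum>a\<in>V. int (card (children a)) - 1)"
    by (rule sum_mono) (auto simp: B_def L_def of_bool_def)
  finally have BL: "int (card B) - int (card L) \<le> -1" by (simp add: sum_children)
  have "special \<subseteq> {r} \<union> K \<union> B"
    using \<open>L \<subseteq> K\<close> by (auto simp: special_def K_def B_def L_def)
  then have "card special \<le> card ({r} \<union> K \<union> B)"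
    using fin by (intro card_mono) auto
  also have "\<dots> \<le> 1 + card K + card B"
    by (metis card_Un_le card.empty card_insert_disjoint empty_iff finite.emptyI One_nat_def
        add_le_cancel_right order_trans)
  \<comment> \<open>The 1 for the root is absorbed because \<open>card B\<close> is strictly less
    than \<open>card L\<close>.\<close>
  finally show ?thesis using BL LK unfolding K_def by linarith
qed

lemma card_degree_not_two:
  "card {v \<in> V. card (E `` {v}) \<noteq> 2} \<le> 6 * card {a \<in> V. connected_without V E a}"
proof -
  have sub: "special \<subseteq> V" by (auto simp: special_def)
  then have fin: "finite special" using finite_V finite_subset by blast
  \<comment> \<open>Vertices outside \<open>special\<close> have exactly one child and contribute 0,
    so the restricted sum is still -1.\<close>
  have "(\<Sum>a\<in>special. int (card (children a)) - 1) = (\<Sum>a\<in>V. int (card (children a)) - 1)"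
    using sub finite_V by (intro sum.mono_neutral_left) (auto simp: special_def)
  then have ch: "(\<Sum>a\<in>special. card (children a)) \<le> card special"
    unfolding sum_children by (simp add: sum_subtractf flip: of_nat_sum)
  have "card {v \<in> V. card (E `` {v}) \<noteq> 2}
      \<le> card (special \<union> (\<Union>a\<in>special. children a) \<union> par ` special)"
    using degree_two_or_near_special fin finite_children by (intro card_mono) auto
  also have "\<dots> \<le> card special + card (\<Union>a\<in>special. children a) + card (par ` special)"
    by (meson add_le_mono1 card_Un_le order_trans)
  also have "\<dots> \<le> card special + card special + card special"
    using card_UN_le[OF fin, of children] ch card_image_le[OF fin, of par] by linarith
  finally show ?thesis using card_special by linarith
qed

end

section \<open>Spanning trees, degrees and cutvertices of a graph\<close>

text \<open>A breadth-first tree: \<open>depth\<close> is the distance from \<open>r\<close>, and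
  the parent of \<open>v\<close> precedes it on a shortest walk.\<close>

lemma ex_rooted_spanning_tree:
  assumes "finite V" "r \<in> V" "E \<subseteq> V \<times> V" "sym E" "\<And>x. (x, x) \<notin> E"
    and conn: "\<And>v. v \<in> V \<Longrightarrow> (r, v) \<in> E\<^sup>*"
  shows "\<exists>par depth. rooted_spanning_tree V E r par depth"
proof -
  define depth where "depth v = (LEAST n. (r, v) \<in> E ^^ n)" for v
  have "\<exists>u. (v, u) \<in> E \<and> depth u < depth v" if v: "v \<in> V" "v \<noteq> r" for v
  proof -
    obtain n where "(r, v) \<in> E ^^ n" using conn v rtrancl_imp_relpow by blast
    then have n: "(r, v) \<in> E ^^ depth v" unfolding depth_def by (rule LeastI)
    then obtain m where m: "depth v = Suc m" using v by (cases "depth v") auto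
    then obtain u where u: "(r, u) \<in> E ^^ m" "(u, v) \<in> E" using n by auto
    then have "depth u \<le> m" unfolding depth_def by (intro Least_le)
    then show ?thesis using u m assms(4) by (auto dest: symD)
  qed
  then obtain par where "\<And>v. v \<in> V \<Longrightarrow> v \<noteq> r \<Longrightarrow> (v, par v) \<in> E \<and> depth (par v) < depth v"
    by metis
  then have "rooted_spanning_tree V E r par depth" using assms by unfold_locales auto
  then show ?thesis by blast
qed

lemma (in graph) out_degree_eq_card_neighbours:
  "out_degree G v = card (arcs_ends G `` {v})"
proof -
  have "inj_on (head G) (out_arcs G v)"
    using no_multi_arcs by (auto simp: inj_on_def arc_to_ends_def)
  moreover have "head G ` out_arcs G v = arcs_ends G `` {v}"
    by (auto simp: arcs_ends_conv)
  ultimately show ?thesis unfolding out_degree_def by (metis card_image)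
qed

text \<open>Walks avoiding \<open>v\<close> are walks in the graph with \<open>v\<close> deleted, so
  that graph is strongly connected unless it is empty.\<close>

lemma (in graph) connected_without_not_cutvertex:
  assumes "connected_without (verts G) (arcs_ends G) v"
  shows "\<not> cutvertex G v"
proof
  assume "cutvertex G v"
  then have ne: "verts (del_vert v) \<noteq> {}" and nc: "\<not> Digraph_Component.connected (del_vert v)"
    by (auto simp: cutvertex_def disconnected_def)
  have ends: "avoiding (arcs_ends G) v = arcs_ends (del_vert v)"
    by (auto simp: avoiding_def arcs_ends_conv del_vert_simps)
  interpret D: wf_digraph "del_vert v" by (rule wf_digraph_del_vert)
  have "strongly_connected (del_vert v)"
  proof (rule strongly_connectedI[OF ne])
    fix x y assume xy: "x \<in> verts (del_vert v)" "y \<in> verts (del_vert v)"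
    then have "(x, y) \<in> (arcs_ends (del_vert v))\<^sup>*"
      using assms by (auto simp: connected_without_def ends del_vert_simps)
    then show "x \<rightarrow>\<^sup>*\<^bsub>del_vert v\<^esub> y"
      unfolding reachable_def using xy
      by (rule rtrancl_consistent_rtrancl_on) auto
  qed
  \<comment> \<open>\<open>connected\<close> means strong connectivity of the symmetric closure, to
    which reachability carries over.\<close>
  then show False using nc D.reachable_mk_symmetricI
    by (auto simp: connected_def strongly_connected_def)
qed

theorem lemma8:
  fixes \<alpha> :: real and H :: "('a, 'b) pre_digraph" and n :: nat
  assumes "\<alpha> > 0"
    and "graph H"
    and "Digraph_Component.connected H"
    and "card (verts H) = n"
    and "real (card {v \<in> verts H. cutvertex H v}) \<ge> (1 - \<alpha>) * real n"
  shows "real (card {v \<in> verts H. out_degree H v = 2}) \<ge> (1 - 7 * \<alpha>) * real n"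
proof -
  interpret graph H by fact
  let ?V = "verts H" and ?E = "arcs_ends H"
  have sc: "strongly_connected H"
    using assms(3) sym_arcs by (intro symmetric_connected_imp_strongly_connected)
  then obtain r where r: "r \<in> ?V" by (auto simp: strongly_connected_def)
  have "\<exists>par depth. rooted_spanning_tree ?V ?E r par depth"
  proof (rule ex_rooted_spanning_tree)
    show "sym ?E" using sym_arcs by (simp add: symmetric_def)
    show "(r, v) \<in> ?E\<^sup>*" if "v \<in> ?V" for v
      using sc r that by (auto simp: strongly_connected_def reachable_def
          intro: rtrancl_on_rtranclI)
  qed (use r adj_not_same in auto)
  then obtain par depth where "rooted_spanning_tree ?V ?E r par depth" by blast
  then interpret rooted_spanning_tree ?V ?E r par depth .
  have compl: "card {v \<in> ?V. P v} + card {v \<in> ?V. \<not> P v} = n" for P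
    using assms(4) card_Int_Diff[of ?V "Collect P"]
    by (simp add: Int_def set_diff_eq)
  have "card {v \<in> ?V. out_degree H v \<noteq> 2} \<le> 6 * card {v \<in> ?V. connected_without ?V ?E v}"
    using card_degree_not_two by (simp add: out_degree_eq_card_neighbours)
  also have "\<dots> \<le> 6 * card {v \<in> ?V. \<not> cutvertex H v}"
    using connected_without_not_cutvertex by (intro mult_le_mono2 card_mono) auto
  finally have "real (card {v \<in> ?V. out_degree H v \<noteq> 2})
      \<le> 6 * real (card {v \<in> ?V. \<not> cutvertex H v})" by linarith
  moreover have "real (card {v \<in> ?V. \<not> cutvertex H v}) \<le> \<alpha> * real n"
    using assms(5) compl[of "cutvertex H"] by (simp add: algebra_simps flip: of_nat_add)
  \<comment> \<open>The count gives the factor 6; the sign of \<alpha> allows 7 in its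
    place.\<close>
  moreover have "0 \<le> \<alpha> * real n" using assms(1) by simp
  ultimately show ?thesis
    using compl[of "\<lambda>v. out_degree H v = 2"] by (simp add: algebra_simps flip: of_nat_add)
qed

end
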